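(* Let $l\in\mathbb{N}$ and let $A\subseteq\mathbb{N}$ be a $C$-set in $(\mathbb{N},+)$. Then the set \[ \{(a,b)\in\mathbb{N}\times\mathbb{N}:\ \{a,a+b,a+2b,\ldots,a+lb\}\subseteq A\} \] is a $C$-set in the semigroup $(\mathbb{N}\times\mathbb{N},+)$ (coordinatewise addition).
   Context: $\mathbb{N}=\{1,2,3,\ldots\}$. For a set $X$, $\mathcal{P}_f(X)$ denotes the set of finite nonempty subsets of $X$, and $S^{\mathbb{N}}$ the set of all sequences $\mathbb{N}\to S$. Let $(S,+)$ be a commutative semigroup. A set $A\subseteq S$ is a $C$-set if it satisfies the conclusion of the Central Sets Theorem: there exist functions $\alpha:\mathcal{P}_f(S^{\mathbb{N}})\to S$ and $H:\mathcal{P}_f(S^{\mathbb{N}})\to\mathcal{P}_f(\mathbb{N})$ such that (1) whenever $F,G\in\mathcal{P}_f(S^{\mathbb{N}})$ with $F\subsetneq G$, one has $\max H(F)<\min H(G)$; and (2) whenever $m\in\mathbb{N}$, $G_1\subsetneq G_2\subsetneq\cdots\subsetneq G_m$ are in $\mathcal{P}_f(S^{\mathbb{N}})$, and $f_i\in G_i$ for $i=1,\ldots,m$, one has $\sum_{i=1}^m\big(\alpha(G_i)+\sum_{t\in H(G_i)}f_i(t)\big)\in A$. *)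

theory Defs
  imports Main "HOL-Library.FuncSet" "HOL-Library.Product_Plus"
begin

text \<open>Throughout, the natural numbers of the mathematical text are the positive ones.\<close>

abbreviation pos_nats :: "nat set" where
  "pos_nats \<equiv> {1..}"

definition fin_subsets :: "'a set \<Rightarrow> 'a set set" where
  "fin_subsets X = {F. F \<subseteq> X \<and> finite F \<and> F \<noteq> {}}"

text \<open>Sequences are extensional, so that two of them are equal as soon as they agree
  on all positive indices; the value at index 0 carries no information.\<close>

definition seqs :: "'a set \<Rightarrow> (nat \<Rightarrow> 'a) set" where
  "seqs S = pos_nats \<rightarrow>\<^sub>E S"

text \<open>A commutative semigroup is represented by a carrier \<open>S\<close>, closed under addition, inside
  a commutative monoid; adjoining a zero shows that every commutative semigroup arises this
  way. The zero need not belong to \<open>S\<close>. It serves only to make \<^const>\<open>sum\<close> available, and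
  all sums below range over finite nonempty index sets. The functions \<open>\<alpha>\<close> and \<open>H\<close> are
  constrained only on \<open>fin_subsets (seqs S)\<close>; their values elsewhere are irrelevant.\<close>

definition C_set :: "'a::comm_monoid_add set \<Rightarrow> 'a set \<Rightarrow> bool" where
  "C_set S A \<longleftrightarrow> A \<subseteq> S \<and>
    (\<exists>\<alpha> H. \<alpha> \<in> fin_subsets (seqs S) \<rightarrow> S \<and>
           H \<in> fin_subsets (seqs S) \<rightarrow> fin_subsets pos_nats \<and>
           (\<forall>F \<in> fin_subsets (seqs S). \<forall>G \<in> fin_subsets (seqs S).
              F \<subset> G \<longrightarrow> Max (H F) < Min (H G)) \<and>
           (\<forall>m \<ge> 1. \<forall>(G :: nat \<Rightarrow> (nat \<Rightarrow> 'a) set) (f :: nat \<Rightarrow> nat \<Rightarrow> 'a).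
              (\<forall>i \<in> {1..m}. G i \<in> fin_subsets (seqs S)) \<longrightarrow>
              (\<forall>i \<in> {1..<m}. G i \<subset> G (Suc i)) \<longrightarrow>
              (\<forall>i \<in> {1..m}. f i \<in> G i) \<longrightarrow>
              (\<Sum>i = 1..m. \<alpha> (G i) + (\<Sum>t \<in> H (G i). f i t)) \<in> A))"

end

theory Submission imports Defs begin

text \<open>A sequence \<open>f = (f\<^sub>1, f\<^sub>2)\<close> of pairs is replaced by the sequences
  \<open>t \<mapsto> (f\<^sub>1 t + 1) + j (f\<^sub>2 t + 1)\<close> for \<open>j \<le> l\<close>. Summing one of them over a finite set \<open>K\<close> yields
  \<open>(|K| + \<Sum>f\<^sub>1) + j (|K| + \<Sum>f\<^sub>2)\<close>, so from witnesses \<open>\<alpha>, H\<close> for \<open>A\<close> one gets the witnesses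
  \<open>(\<alpha> \<Psi> + |H \<Psi>|, |H \<Psi>|)\<close> and \<open>H \<Psi>\<close> for the set of progressions, where \<open>\<Psi>\<close> is the finite set of
  sequences assigned to \<open>G\<close>. The summand 1 next to \<open>f\<^sub>2\<close> keeps the second component of the shift
  positive. Since \<open>\<Psi>\<close> has to be strictly monotone in \<open>G\<close>, it also contains an injective code
  of each member of \<open>G\<close> with first value 1; the summand 1 next to \<open>f\<^sub>1\<close> makes all values of the
  other members at least 2, so codes are never confused with them.\<close>

definition prog_seq :: "nat \<Rightarrow> (nat \<Rightarrow> nat \<times> nat) \<Rightarrow> nat \<Rightarrow> nat" where
  "prog_seq j f = (\<lambda>t\<in>pos_nats. Suc (fst (f t)) + j * Suc (snd (f t)))"

text \<open>Index 1 carries the marker 1, while for positive \<open>t\<close> the two components of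
  \<open>f t\<close> sit at \<open>2 * t\<close> and \<open>2 * t + 1\<close>. These indices are at
  least 2, so the marker displaces no data.\<close>

definition code_seq :: "(nat \<Rightarrow> nat \<times> nat) \<Rightarrow> nat \<Rightarrow> nat" where
  "code_seq f = (\<lambda>t\<in>pos_nats. if t = 1 then 1
     else if even t then fst (f (t div 2)) else snd (f (t div 2)))"

definition prog_family :: "nat \<Rightarrow> (nat \<Rightarrow> nat \<times> nat) set \<Rightarrow> (nat \<Rightarrow> nat) set" where
  "prog_family l G = (\<Union>j\<le>l. prog_seq j ` G) \<union> code_seq ` G"

lemma prog_seq_in_seqs: "prog_seq j f \<in> seqs pos_nats"
  by (auto simp: prog_seq_def seqs_def)

lemma code_seq_in_seqs:
  assumes "f \<in> seqs (pos_nats \<times> pos_nats)"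
  shows "code_seq f \<in> seqs pos_nats"
proof -
  have "f t \<in> pos_nats \<times> pos_nats" if "t \<ge> 1" for t
    using assms that by (auto simp: seqs_def)
  then have "fst (f t) \<ge> 1 \<and> snd (f t) \<ge> 1" if "t \<ge> 1" for t
    using that by (simp add: mem_Times_iff)
  moreover have "t div 2 \<ge> 1" if "t \<ge> 1" "t \<noteq> 1" for t :: nat
    using that by linarith
  ultimately show ?thesis
    unfolding code_seq_def seqs_def by (auto simp: PiE_def Pi_def)
qed

text \<open>Both components of \<open>f t\<close> can be read off at \<open>2 * t\<close> and
  \<open>Suc (2 * t)\<close> for positive \<open>t\<close>; extensionality of sequences settles
  index 0.\<close>

lemma inj_on_code_seq: "inj_on code_seq (seqs S)"
proof (rule inj_onI)
  fix f g assume f: "f \<in> seqs S" and g: "g \<in> seqs S" and eq: "code_seq f = code_seq g"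
  show "f = g"
  proof (rule PiE_ext)
    show "f \<in> pos_nats \<rightarrow>\<^sub>E S" "g \<in> pos_nats \<rightarrow>\<^sub>E S"
      using f g by (simp_all add: seqs_def)
    fix t :: nat assume "t \<in> pos_nats"
    then show "f t = g t"
      using fun_cong[OF eq, of "2 * t"] fun_cong[OF eq, of "Suc (2 * t)"]
      by (simp add: code_seq_def prod_eq_iff)
  qed
qed

lemma prog_seq_neq_code_seq:
  assumes "f \<in> seqs (pos_nats \<times> pos_nats)"
  shows "prog_seq j f \<noteq> code_seq g"
proof
  have "f 1 \<in> pos_nats \<times> pos_nats" using assms by (auto simp: seqs_def)
  then have "fst (f 1) \<ge> 1" by (simp add: mem_Times_iff)
  assume "prog_seq j f = code_seq g"
  then have "prog_seq j f 1 = code_seq g 1" by simp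
  with \<open>fst (f 1) \<ge> 1\<close> show False by (simp add: prog_seq_def code_seq_def)
qed

lemma prog_family_in_fin_subsets:
  assumes "G \<in> fin_subsets (seqs (pos_nats \<times> pos_nats))"
  shows "prog_family l G \<in> fin_subsets (seqs pos_nats)"
  using assms prog_seq_in_seqs code_seq_in_seqs
  unfolding fin_subsets_def prog_family_def by blast

text \<open>The code of a member of \<open>G' - G\<close> is the new element. Without codes
  strictness can fail: for \<open>l = 1\<close> the constant sequences (1,1) and (3,1) already yield
  the constants 2, 4, 6, and adding (1,3) yields only 2 and 6.\<close>

lemma prog_family_strict_mono:
  assumes "G \<subset> G'" "G' \<subseteq> seqs (pos_nats \<times> pos_nats)"
  shows "prog_family l G \<subset> prog_family l G'"
proof -
  obtain f where f: "f \<in> G'" "f \<notin> G" using assms(1) by blast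
  have "code_seq f \<notin> code_seq ` G"
    using f assms inj_on_code_seq[of "pos_nats \<times> pos_nats"] by (auto dest!: inj_onD)
  moreover have "code_seq f \<notin> prog_seq j ` G" for j
  proof
    assume "code_seq f \<in> prog_seq j ` G"
    then obtain g where "g \<in> G" "prog_seq j g = code_seq f" by force
    then show False using prog_seq_neq_code_seq assms by blast
  qed
  ultimately have "code_seq f \<notin> prog_family l G"
    by (simp add: prog_family_def)
  moreover have "code_seq f \<in> prog_family l G'"
    using f by (auto simp: prog_family_def)
  moreover have "prog_family l G \<subseteq> prog_family l G'"
    using assms(1) by (auto simp: prog_family_def)
  ultimately show ?thesis by blast
qed

lemma sum_prog_seq:
  assumes "K \<subseteq> pos_nats"
  shows "(\<Sum>t\<in>K. prog_seq j f t) =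
    (card K + (\<Sum>t\<in>K. fst (f t))) + j * (card K + (\<Sum>t\<in>K. snd (f t)))"
proof -
  have "(\<Sum>t\<in>K. prog_seq j f t) = (\<Sum>t\<in>K. Suc (fst (f t)) + j * Suc (snd (f t)))"
    using assms by (intro sum.cong) (auto simp: prog_seq_def)
  also have "\<dots> = (\<Sum>t\<in>K. Suc (fst (f t))) + j * (\<Sum>t\<in>K. Suc (snd (f t)))"
    by (simp only: sum.distrib sum_distrib_left)
  finally show ?thesis by (simp only: sum_Suc add.commute)
qed

theorem theorem10:
  fixes l :: nat and A :: "nat set"
  assumes "l \<ge> 1"
    and "A \<subseteq> pos_nats"
    and "C_set pos_nats A"
  shows "C_set (pos_nats \<times> pos_nats)
           {(a, b) \<in> pos_nats \<times> pos_nats. {a + i * b | i. i \<le> l} \<subseteq> A}"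
proof -
  let ?T = "pos_nats \<times> pos_nats"
  let ?\<Psi> = "prog_family l"
  obtain \<alpha> H where "\<alpha> \<in> fin_subsets (seqs pos_nats) \<rightarrow> pos_nats"
    and H: "H \<in> fin_subsets (seqs pos_nats) \<rightarrow> fin_subsets pos_nats"
    and mono: "\<forall>F\<in>fin_subsets (seqs pos_nats). \<forall>G\<in>fin_subsets (seqs pos_nats).
       F \<subset> G \<longrightarrow> Max (H F) < Min (H G)"
    and sums: "\<forall>m\<ge>1. \<forall>G f. (\<forall>i\<in>{1..m}. G i \<in> fin_subsets (seqs pos_nats)) \<longrightarrow>
       (\<forall>i\<in>{1..<m}. G i \<subset> G (Suc i)) \<longrightarrow> (\<forall>i\<in>{1..m}. f i \<in> G i) \<longrightarrow>
       (\<Sum>i = 1..m. \<alpha> (G i) + (\<Sum>t\<in>H (G i). f i t)) \<in> A"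
    using assms(3) unfolding C_set_def by (elim conjE exE) (rule that)
  define \<beta> where "\<beta> G = (\<alpha> (?\<Psi> G) + card (H (?\<Psi> G)), card (H (?\<Psi> G)))" for G
  define K where "K G = H (?\<Psi> G)" for G
  have K: "K G \<in> fin_subsets pos_nats" if "G \<in> fin_subsets (seqs ?T)" for G
    using H prog_family_in_fin_subsets[OF that] by (auto simp: K_def)
  have card_K: "card (K G) \<ge> 1" if "G \<in> fin_subsets (seqs ?T)" for G
    using K[OF that] by (simp add: fin_subsets_def Suc_le_eq card_gt_0_iff)
  have \<beta>: "\<beta> G \<in> ?T" if "G \<in> fin_subsets (seqs ?T)" for G
    using card_K[OF that] by (auto simp: \<beta>_def K_def)
  have strict: "?\<Psi> F \<subset> ?\<Psi> G" if "G \<in> fin_subsets (seqs ?T)" "F \<subset> G" for F G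
    using prog_family_strict_mono that by (auto simp: fin_subsets_def)
  have main: "(\<Sum>i = 1..m. \<beta> (G i) + (\<Sum>t\<in>K (G i). f i t))
      \<in> {(a, b) \<in> ?T. {a + i * b | i. i \<le> l} \<subseteq> A}"
    if m: "m \<ge> 1" and G: "\<forall>i\<in>{1..m}. G i \<in> fin_subsets (seqs ?T)"
      and chain: "\<forall>i\<in>{1..<m}. G i \<subset> G (Suc i)" and f: "\<forall>i\<in>{1..m}. f i \<in> G i"
    for m and G :: "nat \<Rightarrow> (nat \<Rightarrow> nat \<times> nat) set" and f
  proof -
    define s where "s = (\<Sum>i = 1..m. \<beta> (G i) + (\<Sum>t\<in>K (G i). f i t))"
    have s1: "fst s = (\<Sum>i = 1..m. \<alpha> (?\<Psi> (G i)) + card (K (G i)) + (\<Sum>t\<in>K (G i). fst (f i t)))"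
      by (simp add: s_def fst_sum \<beta>_def K_def)
    have s2: "snd s = (\<Sum>i = 1..m. card (K (G i)) + (\<Sum>t\<in>K (G i). snd (f i t)))"
      by (simp add: s_def snd_sum \<beta>_def K_def)
    \<comment> \<open>The chain of families, and with it every value of \<open>\<alpha>\<close> and
      \<open>H\<close>, is the same for all \<open>j\<close>; only the chosen members
      \<open>prog_seq j (f i)\<close> change. Hence one pair \<open>s\<close> serves every
      \<open>j\<close>.\<close>
    have prog: "fst s + j * snd s \<in> A" if "j \<le> l" for j
    proof -
      have "(\<Sum>i = 1..m. \<alpha> (?\<Psi> (G i)) + (\<Sum>t\<in>H (?\<Psi> (G i)). prog_seq j (f i) t)) \<in> A"
      proof (rule sums[THEN spec, THEN mp, THEN spec, THEN spec, THEN mp, THEN mp, THEN mp])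
        show "1 \<le> m" by (rule m)
        show "\<forall>i\<in>{1..m}. ?\<Psi> (G i) \<in> fin_subsets (seqs pos_nats)"
          using G prog_family_in_fin_subsets by blast
        show "\<forall>i\<in>{1..<m}. ?\<Psi> (G i) \<subset> ?\<Psi> (G (Suc i))"
          using G chain strict by auto
        show "\<forall>i\<in>{1..m}. prog_seq j (f i) \<in> ?\<Psi> (G i)"
          using f \<open>j \<le> l\<close> by (auto simp: prog_family_def)
      qed
      also have "(\<Sum>i = 1..m. \<alpha> (?\<Psi> (G i)) + (\<Sum>t\<in>H (?\<Psi> (G i)). prog_seq j (f i) t)) =
        (\<Sum>i = 1..m. (\<alpha> (?\<Psi> (G i)) + card (K (G i)) + (\<Sum>t\<in>K (G i). fst (f i t)))
           + j * (card (K (G i)) + (\<Sum>t\<in>K (G i). snd (f i t))))"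
      proof (rule sum.cong)
        fix i assume "i \<in> {1..m}"
        then have "K (G i) \<subseteq> pos_nats" using K G by (auto simp: fin_subsets_def)
        from sum_prog_seq[OF this, of j "f i"]
        show "\<alpha> (?\<Psi> (G i)) + (\<Sum>t\<in>H (?\<Psi> (G i)). prog_seq j (f i) t) =
          (\<alpha> (?\<Psi> (G i)) + card (K (G i)) + (\<Sum>t\<in>K (G i). fst (f i t)))
           + j * (card (K (G i)) + (\<Sum>t\<in>K (G i). snd (f i t)))"
          by (simp add: K_def)
      qed simp
      also have "\<dots> = fst s + j * snd s"
        unfolding s1 s2 by (simp only: sum.distrib sum_distrib_left distrib_left)
      finally show ?thesis .
    qed
    \<comment> \<open>The case \<open>j = 0\<close> puts \<open>fst s\<close> itself into
      \<open>A\<close>, whose elements are positive.\<close>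
    have "fst s \<ge> 1" using prog[of 0] assms(2) by auto
    moreover have "snd s \<ge> 1"
    proof -
      \<comment> \<open>The values of \<open>H\<close> are nonempty, so the summand for
        \<open>i = 1\<close> alone is already positive.\<close>
      have "1 \<le> card (K (G 1))" using card_K G m by auto
      also have "\<dots> \<le> card (K (G 1)) + (\<Sum>t\<in>K (G 1). snd (f 1 t))" by simp
      also have "\<dots> \<le> snd s"
        unfolding s2 using m by (intro member_le_sum) auto
      finally show ?thesis .
    qed
    ultimately show ?thesis
      unfolding s_def[symmetric] using prog by (auto simp: case_prod_unfold mem_Times_iff)
  qed
  show ?thesis
    unfolding C_set_def
  proof (intro conjI exI[of _ \<beta>] exI[of _ K] allI impI)
    show "{(a, b) \<in> ?T. {a + i * b | i. i \<le> l} \<subseteq> A} \<subseteq> ?T" by blast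
    show "\<beta> \<in> fin_subsets (seqs ?T) \<rightarrow> ?T" using \<beta> by (rule Pi_I)
    show "K \<in> fin_subsets (seqs ?T) \<rightarrow> fin_subsets pos_nats" using K by (rule Pi_I)
    show "\<forall>F\<in>fin_subsets (seqs ?T). \<forall>G\<in>fin_subsets (seqs ?T). F \<subset> G \<longrightarrow> Max (K F) < Min (K G)"
    proof (intro ballI impI)
      \<comment> \<open>Strict inclusion passes from \<open>F\<close> and \<open>G\<close> to their
        families, where the separation property of \<open>H\<close> applies.\<close>
      fix F G assume "F \<in> fin_subsets (seqs ?T)" "G \<in> fin_subsets (seqs ?T)" "F \<subset> G"
      then show "Max (K F) < Min (K G)"
        unfolding K_def by (intro mono[rule_format] prog_family_in_fin_subsets strict)
    qed
  qed (rule main; assumption)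
qed

end
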